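(* Let $d\ge1$, let $\hat a_j$, $j=1,\dots,d$, be admissible univariate functions of type (a) satisfying $0\le\hat a_j(t)\le1$, and let $\hat A(t)=\prod_{j=1}^d\hat a_j(t_j)$, $t\in[0,\infty)^d$. Define a cutoff function $\hat C$ on $[0,\infty)^d$ in either of two ways, namely $$\hat C(t):=\begin{cases}1-\hat A^2(2t),&t\in\mathcal{B}_\infty,\\ \hat A(t)\sqrt{2-\hat A^2(t)},&t\in2\mathcal{B}_\infty\setminus\mathcal{B}_\infty,\\0,&t\notin2\mathcal{B}_\infty,\end{cases}$$ or $$\hat C(t):=\begin{cases}0,&t\in\frac12\mathcal{B}_\infty,\\ \cos\big(\frac\pi2\hat A(2t)\big),&t\in\mathcal{B}_\infty\setminus\frac12\mathcal{B}_\infty,\\ \sin\big(\frac\pi2\hat A(t)\big),&t\in2\mathcal{B}_\infty\setminus\mathcal{B}_\infty,\\0,&t\notin2\mathcal{B}_\infty.\end{cases}$$ Then (in each of the two cases) the function $\hat C\ge0$ is admissible of second kind and type (c).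
   Context: $\mathcal{B}_p=\{t\in[0,\infty)^d:\|t\|_p\le1\}$ for $p=1,\infty$. A univariate function $\hat a\in C^\infty[0,\infty)$ is admissible of type (a) if $\operatorname{supp}\hat a\subset[0,2]$, $\hat a^{(m)}(0)=0$ for $m\ge1$, and $\hat a(t)=1$ for $t\in[0,1]$. Let $\operatorname{proj}_k t$ denote $t\in\mathbb{R}^d$ with its $k$th coordinate replaced by $0$. A function $\hat C\in C^\infty[0,\infty)^d$ is an admissible cutoff function of second kind and type (c) if $\operatorname{supp}\hat C\subset[0,2]^d$, $\hat C(t)=\hat C(\operatorname{proj}_k t)$ for every $t\in[0,\infty)^d$ and every $k$ such that $t_k\le\frac12\|t\|_\infty$, $\hat C(t)=0$ if $t\in\frac12\mathcal{B}_1$, and $\sum_{j=0}^\infty|\hat C(2^{-j}t)|^2=1$ for $t\in[0,\infty)^d\setminus[0,1)^d$. *)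

theory Defs
  imports "HOL-Analysis.Analysis"
begin

definition orthant :: "(real ^ 'n) set" where
  "orthant = {t. \<forall>k. 0 \<le> t $ k}"

text \<open>
  \<open>C_on n S f\<close>: \<open>f\<close> is \<open>n\<close> times continuously differentiable on \<open>S\<close>, with derivatives
  taken within \<open>S\<close>, hence one-sided at boundary points. The definition is meant for sets
  \<open>S\<close> such as \<open>[0,\<infinity>)\<close> and \<open>[0,\<infinity>)\<^sup>d\<close>, on which the derivative within \<open>S\<close> is unique;
  the existentially quantified \<open>f'\<close> is then determined on \<open>S\<close>.
  Only the values of \<open>f\<close> on \<open>S\<close> matter.
\<close>

primrec C_on :: "nat \<Rightarrow> 'a::euclidean_space set \<Rightarrow> ('a \<Rightarrow> real) \<Rightarrow> bool" where
  "C_on 0 S f \<longleftrightarrow> continuous_on S f"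
| "C_on (Suc n) S f \<longleftrightarrow>
     (\<exists>f'. (\<forall>x\<in>S. (f has_derivative f' x) (at x within S)) \<and>
           (\<forall>v. C_on n S (\<lambda>x. f' x v)))"

definition smooth_on :: "'a::euclidean_space set \<Rightarrow> ('a \<Rightarrow> real) \<Rightarrow> bool" where
  "smooth_on S f \<longleftrightarrow> (\<forall>n. C_on n S f)"

definition supp_on :: "'a::euclidean_space set \<Rightarrow> ('a \<Rightarrow> real) \<Rightarrow> 'a set" where
  "supp_on S f = closure (support_on S f)"

text \<open>The derivative is taken within \<open>[0,\<infinity>)\<close>, hence one-sided at \<open>0\<close>.\<close>

definition nth_deriv_nonneg :: "nat \<Rightarrow> (real \<Rightarrow> real) \<Rightarrow> real \<Rightarrow> real" where
  "nth_deriv_nonneg m f = ((\<lambda>g x. vector_derivative g (at x within {0..})) ^^ m) f"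


definition B_1 :: "(real ^ 'n) set" where
  "B_1 = {t \<in> orthant. (\<Sum>k\<in>UNIV. \<bar>t $ k\<bar>) \<le> 1}"

text \<open>The library's \<open>infnorm\<close> is the maximum norm with respect to the standard basis.\<close>

definition B_inf :: "(real ^ 'n) set" where
  "B_inf = {t \<in> orthant. infnorm t \<le> 1}"

definition dilate :: "real \<Rightarrow> (real ^ 'n) set \<Rightarrow> (real ^ 'n) set" where
  "dilate r S = (\<lambda>t. r *\<^sub>R t) ` S"

definition proj :: "'n \<Rightarrow> real ^ 'n \<Rightarrow> real ^ 'n" where
  "proj k t = (\<chi> i. if i = k then 0 else t $ i)"


definition admissible_a :: "(real \<Rightarrow> real) \<Rightarrow> bool" where
  "admissible_a a \<longleftrightarrow>
     smooth_on {0..} a \<and>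
     supp_on {0..} a \<subseteq> {0..2} \<and>
     (\<forall>m\<ge>1. nth_deriv_nonneg m a 0 = 0) \<and>
     (\<forall>t\<in>{0..1}. a t = 1)"

definition admissible_second_kind_c :: "(real ^ 'n \<Rightarrow> real) \<Rightarrow> bool" where
  "admissible_second_kind_c C \<longleftrightarrow>
     smooth_on orthant C \<and>
     supp_on orthant C \<subseteq> {t. \<forall>k. t $ k \<in> {0..2}} \<and>
     (\<forall>t\<in>orthant. \<forall>k. t $ k \<le> 1/2 * infnorm t \<longrightarrow> C t = C (proj k t)) \<and>
     (\<forall>t\<in>dilate (1/2) B_1. C t = 0) \<and>
     (\<forall>t\<in>orthant - {t. \<forall>k. t $ k \<in> {0..<1}}.
        (\<lambda>j. \<bar>C ((1 / 2 ^ j) *\<^sub>R t)\<bar>\<^sup>2) sums 1)"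


definition A_prod :: "('n::finite \<Rightarrow> real \<Rightarrow> real) \<Rightarrow> real ^ 'n \<Rightarrow> real" where
  "A_prod a t = (\<Prod>j\<in>UNIV. a j (t $ j))"

definition C_sqrt :: "('n::finite \<Rightarrow> real \<Rightarrow> real) \<Rightarrow> real ^ 'n \<Rightarrow> real" where
  "C_sqrt a t =
     (if t \<in> B_inf then 1 - (A_prod a (2 *\<^sub>R t))\<^sup>2
      else if t \<in> dilate 2 B_inf - B_inf then A_prod a t * sqrt (2 - (A_prod a t)\<^sup>2)
      else 0)"

definition C_trig :: "('n::finite \<Rightarrow> real \<Rightarrow> real) \<Rightarrow> real ^ 'n \<Rightarrow> real" where
  "C_trig a t =
     (if t \<in> dilate (1/2) B_inf then 0
      else if t \<in> B_inf - dilate (1/2) B_inf then cos (pi / 2 * A_prod a (2 *\<^sub>R t))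
      else if t \<in> dilate 2 B_inf - B_inf then sin (pi / 2 * A_prod a t)
      else 0)"

end

theory Submission
  imports Defs
begin

text \<open>
  Both cutoff functions have the form \<open>C(t) = g(A(t)) h(A(2t))\<close> on the whole orthant, where
  \<open>g\<close> and \<open>h\<close> are smooth on \<open>[0,1]\<close> and satisfy \<open>g\<^sup>2 + h\<^sup>2 = 1\<close>, \<open>g(0) = 0\<close>, \<open>h(1) = 0\<close>: for
  the first one \<open>g(s) = s sqrt(2 - s\<^sup>2)\<close> and \<open>h(s) = 1 - s\<^sup>2\<close>, for the second one
  \<open>g(s) = sin(\<pi>s/2)\<close> and \<open>h(s) = cos(\<pi>s/2)\<close>. The case distinctions disappear because
  \<open>A(t) = 1\<close> when \<open>\<parallel>t\<parallel>\<^sub>\<infinity> \<le> 1\<close> and \<open>A(2t) = 0\<close> when \<open>\<parallel>t\<parallel>\<^sub>\<infinity> \<ge> 1\<close>, so at every point one of the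
  two factors is trivial (\<open>C_sqrt_eq\<close>, \<open>C_trig_eq\<close>). In particular no matching of derivatives along the interfaces
  has to be checked: smoothness of \<open>C\<close> is closure of smooth functions under products and
  composition.

  The partition of unity telescopes. Since \<open>A(t) = 1\<close> wherever \<open>A(2t) \<noteq> 0\<close>, one has
  \<open>C(t)\<^sup>2 = g(A(t))\<^sup>2 (1 - g(A(2t))\<^sup>2) = g(A(t))\<^sup>2 - g(A(2t))\<^sup>2\<close>; summing over the dyadic
  dilates of \<open>t\<close> leaves \<open>g(1)\<^sup>2 - g(A(2t))\<^sup>2\<close>, which is \<open>1\<close> as soon as some coordinate of
  \<open>t\<close> is at least \<open>1\<close> (\<open>admissible_second_kind_c_quadrature\<close>).

  The invariance under \<open>t \<mapsto> proj\<^sub>k t\<close> already holds for \<open>A\<close>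
  (\<open>A_prod_proj\<close>), and therefore for \<open>C\<close>, because the condition
  \<open>t\<^sub>k \<le> \<parallel>t\<parallel>\<^sub>\<infinity>/2\<close> is preserved by dilation.
\<close>

section \<open>Calculus of functions with continuous derivatives within a set\<close>

lemma C_on_SucE:
  assumes "C_on (Suc n) S f"
  obtains f' where "\<And>x. x \<in> S \<Longrightarrow> (f has_derivative f' x) (at x within S)"
    and "\<And>v. C_on n S (\<lambda>x. f' x v)"
  using assms unfolding C_on.simps by blast

lemma C_on_cong:
  assumes "\<And>x. x \<in> S \<Longrightarrow> f x = g x" "C_on n S f"
  shows "C_on n S g"
proof (cases n)
  case 0
  then show ?thesis using assms by (simp cong: continuous_on_cong)
next
  case (Suc m)
  obtain f' where f': "\<And>x. x \<in> S \<Longrightarrow> (f has_derivative f' x) (at x within S)"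
    and "\<And>v. C_on m S (\<lambda>x. f' x v)"
    using C_on_SucE[OF assms(2)[unfolded Suc]] by blast
  moreover have "(g has_derivative f' x) (at x within S)" if "x \<in> S" for x
    using has_derivative_transform[OF that _ f'[OF that]] assms(1) by simp
  ultimately show ?thesis
    unfolding Suc C_on.simps by blast
qed

lemma smooth_on_cong:
  assumes "\<And>x. x \<in> S \<Longrightarrow> f x = g x" "smooth_on S f"
  shows "smooth_on S g"
  using assms C_on_cong unfolding smooth_on_def by blast

lemma C_on_Suc_imp: "C_on (Suc n) S f \<Longrightarrow> C_on n S f"
proof (induction n arbitrary: f)
  case 0
  then show ?case
    by (auto simp: continuous_on_eq_continuous_within intro: has_derivative_continuous)
next
  case (Suc n)
  then show ?case by (metis C_on.simps(2))
qed

lemma C_on_const: "C_on n S (\<lambda>x. c)"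
proof (induction n arbitrary: c)
  case (Suc n)
  show ?case
    unfolding C_on.simps by (rule exI[of _ "\<lambda>x v. 0"]) (simp add: Suc)
qed simp

lemma C_on_bounded_linear:
  assumes "bounded_linear f"
  shows "C_on n S f"
proof (cases n)
  case 0
  then show ?thesis using assms by (simp add: linear_continuous_on)
next
  case (Suc m)
  show ?thesis
    unfolding Suc C_on.simps
    by (rule exI[of _ "\<lambda>x. f"])
      (simp add: C_on_const bounded_linear_imp_has_derivative assms)
qed

lemma C_on_add:
  assumes "C_on n S f" "C_on n S g"
  shows "C_on n S (\<lambda>x. f x + g x)"
  using assms
proof (induction n arbitrary: f g)
  case 0
  then show ?case by (auto intro: continuous_intros)
next
  case (Suc n)
  obtain f' where
    "\<And>x. x \<in> S \<Longrightarrow> (f has_derivative f' x) (at x within S)" "\<And>v. C_on n S (\<lambda>x. f' x v)"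
    using C_on_SucE[OF Suc.prems(1)] by blast
  moreover obtain g' where
    "\<And>x. x \<in> S \<Longrightarrow> (g has_derivative g' x) (at x within S)" "\<And>v. C_on n S (\<lambda>x. g' x v)"
    using C_on_SucE[OF Suc.prems(2)] by blast
  ultimately show ?case
    unfolding C_on.simps
    by (intro exI[of _ "\<lambda>x v. f' x v + g' x v"]) (auto intro: has_derivative_add Suc.IH)
qed

lemma C_on_mult:
  assumes "C_on n S f" "C_on n S g"
  shows "C_on n S (\<lambda>x. f x * g x)"
  using assms
proof (induction n arbitrary: f g)
  case 0
  then show ?case by (auto intro: continuous_intros)
next
  case (Suc n)
  obtain f' where
    "\<And>x. x \<in> S \<Longrightarrow> (f has_derivative f' x) (at x within S)" "\<And>v. C_on n S (\<lambda>x. f' x v)"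
    using C_on_SucE[OF Suc.prems(1)] by blast
  moreover obtain g' where
    "\<And>x. x \<in> S \<Longrightarrow> (g has_derivative g' x) (at x within S)" "\<And>v. C_on n S (\<lambda>x. g' x v)"
    using C_on_SucE[OF Suc.prems(2)] by blast
  moreover have "C_on n S f" "C_on n S g"
    using Suc.prems C_on_Suc_imp by blast+
  ultimately show ?case
    unfolding C_on.simps
    by (intro exI[of _ "\<lambda>x v. f x * g' x v + f' x v * g x"])
      (auto intro!: has_derivative_mult Suc.IH C_on_add)
qed

text \<open>
  The derivative of \<open>g \<circ> f\<close> in direction \<open>v\<close> is \<open>g'(f(x)) \<cdot> f'(x)v\<close>, a product of a
  composition and a directional derivative of lower order.
\<close>
lemma C_on_compose:
  fixes g :: "real \<Rightarrow> real"
  assumes "C_on n S f" "C_on n T g" "f ` S \<subseteq> T"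
  shows "C_on n S (\<lambda>x. g (f x))"
  using assms
proof (induction n arbitrary: f g)
  case 0
  then show ?case by (auto intro: continuous_on_compose2)
next
  case (Suc n)
  obtain f' where
    f: "\<And>x. x \<in> S \<Longrightarrow> (f has_derivative f' x) (at x within S)" "\<And>v. C_on n S (\<lambda>x. f' x v)"
    using C_on_SucE[OF Suc.prems(1)] by blast
  obtain g' where
    g: "\<And>y. y \<in> T \<Longrightarrow> (g has_derivative g' y) (at y within T)" "\<And>v. C_on n T (\<lambda>y. g' y v)"
    using C_on_SucE[OF Suc.prems(2)] by blast
  have "((\<lambda>x. g (f x)) has_derivative (\<lambda>v. f' x v * g' (f x) 1)) (at x within S)"
    if "x \<in> S" for x
  proof -
    have d: "(g has_derivative g' (f x)) (at (f x) within T)"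
      using that Suc.prems(3) g(1) by blast
    have "((\<lambda>x. g (f x)) has_derivative (\<lambda>v. g' (f x) (f' x v))) (at x within S)"
      using has_derivative_in_compose[OF f(1)[OF that] has_derivative_subset[OF d Suc.prems(3)]] .
    moreover have "g' (f x) r = r * g' (f x) 1" for r
      using linear_scale[OF has_derivative_linear[OF d], of r 1] by simp
    then have "(\<lambda>v. g' (f x) (f' x v)) = (\<lambda>v. f' x v * g' (f x) 1)" by blast
    ultimately show ?thesis by simp
  qed
  moreover have "C_on n S (\<lambda>x. f' x v * g' (f x) 1)" for v
    using C_on_mult[OF f(2) Suc.IH[OF C_on_Suc_imp[OF Suc.prems(1)] g(2) Suc.prems(3)]] .
  ultimately show ?case
    unfolding C_on.simps by (intro exI[of _ "\<lambda>x v. f' x v * g' (f x) 1"]) blast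
qed

lemma smooth_on_const: "smooth_on S (\<lambda>x. c)"
  by (simp add: smooth_on_def C_on_const)

lemma smooth_on_bounded_linear: "bounded_linear f \<Longrightarrow> smooth_on S f"
  by (simp add: smooth_on_def C_on_bounded_linear)

lemma smooth_on_add: "smooth_on S f \<Longrightarrow> smooth_on S g \<Longrightarrow> smooth_on S (\<lambda>x. f x + g x)"
  by (simp add: smooth_on_def C_on_add)

lemma smooth_on_mult: "smooth_on S f \<Longrightarrow> smooth_on S g \<Longrightarrow> smooth_on S (\<lambda>x. f x * g x)"
  by (simp add: smooth_on_def C_on_mult)

lemma smooth_on_compose:
  fixes g :: "real \<Rightarrow> real"
  assumes "smooth_on T g" "smooth_on S f" "f ` S \<subseteq> T"
  shows "smooth_on S (\<lambda>x. g (f x))"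
  using assms by (auto simp: smooth_on_def intro: C_on_compose)

lemma smooth_on_prod:
  assumes "finite I" "\<And>i. i \<in> I \<Longrightarrow> smooth_on S (f i)"
  shows "smooth_on S (\<lambda>x. \<Prod>i\<in>I. f i x)"
  using assms by (induction I) (auto intro: smooth_on_const smooth_on_mult)

text \<open>
  The powers with arbitrary real exponents form a family closed under differentiation up to
  constants, so the induction goes through for all of them at once. The square root is the
  member with exponent \<open>1/2\<close>.
\<close>
lemma C_on_powr: "C_on n {0<..} (\<lambda>x::real. x powr p)"
proof (induction n arbitrary: p)
  case 0
  show ?case by (auto intro!: continuous_intros)
next
  case (Suc n)
  have "((\<lambda>x. x powr p) has_derivative (\<lambda>v. v * p * x powr (p - 1))) (at x within {0<..})"
    if "x > 0" for x
    using has_derivative_at_withinI[OF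
        has_real_derivative_powr[OF that, of p, unfolded has_field_derivative_def]]
    by (rule has_derivative_eq_rhs) (simp add: fun_eq_iff)
  then show ?case
    unfolding C_on.simps
    by (intro exI[of _ "\<lambda>x v. v * p * x powr (p - 1)"]) (auto intro: C_on_mult C_on_const Suc)
qed

lemma smooth_on_sqrt: "smooth_on {0<..} sqrt"
  by (rule smooth_on_cong[of _ "\<lambda>x. x powr (1/2)"])
    (auto simp: powr_half_sqrt smooth_on_def C_on_powr)

text \<open>
  The shifts of the sine, which include the cosine, are closed under differentiation, so sine
  and cosine need only one induction.
\<close>
lemma C_on_sin: "C_on n S (\<lambda>x. sin (x + c))"
proof (induction n arbitrary: c)
  case 0
  show ?case by (auto intro!: continuous_intros)
next
  case (Suc n)
  have "((\<lambda>x. sin (x + c)) has_derivative (\<lambda>v. v * sin (x + (c + pi/2)))) (at x within S)" for x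
  proof -
    have "((\<lambda>x. sin (x + c)) has_derivative (\<lambda>v. v * cos (x + c))) (at x within S)"
      by (auto intro!: derivative_eq_intros)
    moreover have "sin (x + (c + pi/2)) = cos (x + c)"
      using sin_add[of "x + c" "pi/2"] by (simp add: add.assoc)
    ultimately show ?thesis by simp
  qed
  then show ?case
    unfolding C_on.simps
    by (intro exI[of _ "\<lambda>x v. v * sin (x + (c + pi/2))"]) (auto intro: C_on_mult C_on_const Suc)
qed

lemma smooth_on_sin: "smooth_on S sin"
  using C_on_sin[of _ S 0] by (simp add: smooth_on_def)

lemma smooth_on_cos: "smooth_on S cos"
  using C_on_sin[of _ S "pi/2"] by (simp add: smooth_on_def sin_add)


section \<open>The maximum norm on the orthant\<close>

lemma scaleR_orthant: "t \<in> orthant \<Longrightarrow> 0 \<le> r \<Longrightarrow> r *\<^sub>R t \<in> orthant"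
  by (simp add: orthant_def)

lemma proj_orthant: "t \<in> orthant \<Longrightarrow> proj k t \<in> orthant"
  by (simp add: orthant_def proj_def)

lemma infnorm_le_iff_orthant:
  fixes t :: "real ^ 'n::finite"
  assumes "t \<in> orthant"
  shows "infnorm t \<le> r \<longleftrightarrow> (\<forall>k. t $ k \<le> r)"
proof
  assume *: "infnorm t \<le> r"
  show "\<forall>k. t $ k \<le> r"
  proof
    fix k
    have "t $ k \<le> \<bar>t $ k\<bar>" by simp
    also have "\<dots> \<le> infnorm t" by (rule component_le_infnorm_cart)
    finally show "t $ k \<le> r" using * by simp
  qed
next
  assume "\<forall>k. t $ k \<le> r"
  then show "infnorm t \<le> r"
    unfolding infnorm_cart using assms by (intro cSup_least) (auto simp: orthant_def)
qed

lemma dilate_B_inf_iff: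
  fixes t :: "real ^ 'n::finite"
  assumes "r > 0"
  shows "t \<in> dilate r B_inf \<longleftrightarrow> t \<in> orthant \<and> (\<forall>k. t $ k \<le> r)"
proof
  assume "t \<in> dilate r B_inf"
  then obtain s where s: "s \<in> orthant" "infnorm s \<le> 1" "t = r *\<^sub>R s"
    by (auto simp: dilate_def B_inf_def)
  then show "t \<in> orthant \<and> (\<forall>k. t $ k \<le> r)"
    using assms by (auto simp: infnorm_le_iff_orthant orthant_def mult_left_le)
next
  assume t: "t \<in> orthant \<and> (\<forall>k. t $ k \<le> r)"
  then have "inverse r *\<^sub>R t \<in> B_inf"
    using assms scaleR_orthant[of t "inverse r"]
    by (auto simp: B_inf_def infnorm_le_iff_orthant field_simps)
  moreover have "t = r *\<^sub>R (inverse r *\<^sub>R t)" using assms by simp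
  ultimately show "t \<in> dilate r B_inf" unfolding dilate_def by blast
qed

lemma B_inf_iff: "t \<in> B_inf \<longleftrightarrow> t \<in> orthant \<and> (\<forall>k. t $ k \<le> 1)"
  for t :: "real ^ 'n::finite"
  by (auto simp: B_inf_def infnorm_le_iff_orthant)


section \<open>The tensor product of univariate cutoffs\<close>

text \<open>At the endpoint \<open>2\<close> of the support the value vanishes by continuity.\<close>
lemma admissible_a_eq_0:
  assumes "admissible_a a" "t \<ge> 2"
  shows "a t = 0"
proof -
  have "a s = 0" if "s > 2" for s
  proof (rule ccontr)
    assume "a s \<noteq> 0"
    then have "s \<in> supp_on {0..} a"
      using that closure_subset by (fastforce simp: supp_on_def support_on_def)
    then show False using assms(1) that by (auto simp: admissible_a_def)
  qed
  moreover have "continuous_on (closure {2<..}) a"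
  proof -
    have "C_on 0 {0..} a" using assms(1) unfolding admissible_a_def smooth_on_def by blast
    then show ?thesis by (auto intro: continuous_on_subset)
  qed
  ultimately show ?thesis
    using continuous_constant_on_closure[of "{2<..}" a 0 t] assms(2) by simp
qed

context
  fixes a :: "'n::finite \<Rightarrow> real \<Rightarrow> real"
  assumes adm: "\<And>j. admissible_a (a j)"
    and range: "\<forall>j. \<forall>t\<ge>0. 0 \<le> a j t \<and> a j t \<le> 1"
begin

lemma A_prod_range:
  assumes "t \<in> orthant"
  shows "A_prod a t \<in> {0..1}"
  using assms range unfolding A_prod_def orthant_def
  by (auto intro!: prod_nonneg prod_le_1)

lemma A_prod_eq_1:
  assumes "t \<in> orthant" "\<And>k. t $ k \<le> 1"
  shows "A_prod a t = 1"
  using assms adm unfolding A_prod_def orthant_def admissible_a_def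
  by (intro prod.neutral) auto

lemma A_prod_eq_0:
  assumes "t $ k \<ge> 2"
  shows "A_prod a t = 0"
  using assms admissible_a_eq_0[OF adm] unfolding A_prod_def by (intro prod_zero) auto

lemma smooth_on_A_prod_scaleR:
  assumes "r \<ge> 0"
  shows "smooth_on orthant (\<lambda>t. A_prod a (r *\<^sub>R t))"
  unfolding A_prod_def
proof (rule smooth_on_prod)
  fix j :: 'n
  have "smooth_on {0..} (a j)" using adm by (simp add: admissible_a_def)
  moreover have "smooth_on orthant (\<lambda>t :: real ^ 'n. (r *\<^sub>R t) $ j)"
    by (rule smooth_on_bounded_linear, rule bounded_linear_compose[OF bounded_linear_vec_nth])
      (rule bounded_linear_scaleR_right)
  moreover have "(\<lambda>t :: real ^ 'n. (r *\<^sub>R t) $ j) ` orthant \<subseteq> {0..}"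
    using assms by (auto simp: orthant_def)
  ultimately show "smooth_on orthant (\<lambda>t. a j ((r *\<^sub>R t) $ j))"
    by (rule smooth_on_compose)
qed simp

text \<open>
  If \<open>\<parallel>t\<parallel>\<^sub>\<infinity> \<le> 2\<close>, then \<open>t\<^sub>k \<le> 1\<close> and the \<open>k\<close>th factor is \<open>1\<close>, as it is at \<open>0\<close>. Otherwise a
  coordinate other than the \<open>k\<close>th exceeds \<open>2\<close>, and it makes the product vanish at both points.
\<close>
lemma A_prod_proj:
  assumes t: "t \<in> orthant" and k: "t $ k \<le> 1/2 * infnorm t"
  shows "A_prod a (proj k t) = A_prod a t"
proof (cases "infnorm t \<le> 2")
  case True
  then have "t $ k \<le> 1" using k by simp
  then have "a k (t $ k) = 1" "a k 0 = 1"
    using t adm by (auto simp: admissible_a_def orthant_def)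
  then show ?thesis
    unfolding A_prod_def by (intro prod.cong) (auto simp: proj_def)
next
  case False
  then obtain i where i: "t $ i \<ge> 2" "i \<noteq> k"
  proof -
    \<comment> \<open>Exceeding \<open>t\<^sub>k\<close> as well as \<open>2\<close> ensures that the large coordinate is not the \<open>k\<close>th.\<close>
    have "\<not> infnorm t \<le> max 2 (t $ k)" using False k by linarith
    then obtain i where "t $ i > max 2 (t $ k)"
      using infnorm_le_iff_orthant[OF t, of "max 2 (t $ k)"] by (auto simp: not_le)
    then show ?thesis using that[of i] by auto
  qed
  then have "proj k t $ i \<ge> 2" by (simp add: proj_def)
  with i(1) show ?thesis by (metis A_prod_eq_0)
qed


section \<open>Cutoffs of the form \<open>g(A(t)) h(A(2t))\<close>\<close>

text \<open>
  The identity \<open>g\<^sup>2 + h\<^sup>2 = 1\<close> makes the squares telescope, \<open>g(0) = 0\<close> bounds the support of \<open>C\<close>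
  by that of \<open>A\<close>, and \<open>h(1) = 0\<close> makes \<open>C\<close> vanish near the origin, where \<open>A(2t) = 1\<close>.
  The normalization \<open>g(1)\<^sup>2 = 1\<close>, the limit of the telescoping sum, follows from \<open>h(1) = 0\<close>.
\<close>
lemma admissible_second_kind_c_quadrature:
  fixes C :: "real ^ 'n \<Rightarrow> real" and g h :: "real \<Rightarrow> real"
  assumes C: "\<And>t. t \<in> orthant \<Longrightarrow> C t = g (A_prod a t) * h (A_prod a (2 *\<^sub>R t))"
    and smooth: "smooth_on {0..1} g" "smooth_on {0..1} h"
    and gh: "\<And>s. s \<in> {0..1} \<Longrightarrow> (g s)\<^sup>2 + (h s)\<^sup>2 = 1"
    and g0: "g 0 = 0" and h1: "h 1 = 0"
  shows "admissible_second_kind_c C"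
  unfolding admissible_second_kind_c_def
proof (intro conjI ballI allI impI)
  have "smooth_on orthant (\<lambda>t. g (A_prod a (1 *\<^sub>R t)) * h (A_prod a (2 *\<^sub>R t)))"
    by (intro smooth_on_mult smooth_on_compose[OF smooth(1)] smooth_on_compose[OF smooth(2)]
        smooth_on_A_prod_scaleR image_subsetI A_prod_range scaleR_orthant) auto
  then show "smooth_on orthant C"
    by (rule smooth_on_cong[rotated]) (simp add: C)
next
  have "t $ k \<in> {0..2}" if "t \<in> support_on orthant C" for t k
  proof -
    have "t \<in> orthant" "g (A_prod a t) \<noteq> 0"
      using that C[of t] by (auto simp: support_on_def)
    then show ?thesis using A_prod_eq_0[of t k] g0 by (force simp: orthant_def)
  qed
  moreover have "closed {t :: real ^ 'n. \<forall>k. t $ k \<in> {0..2}}"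
    by (simp add: closed_Collect_all closed_Collect_conj closed_Collect_le continuous_on_component)
  ultimately show "supp_on orthant C \<subseteq> {t. \<forall>k. t $ k \<in> {0..2}}"
    unfolding supp_on_def by (intro closure_minimal) auto
next
  fix t :: "real ^ 'n" and k
  assume t: "t \<in> orthant" and k: "t $ k \<le> 1/2 * infnorm t"
  have "proj k (2 *\<^sub>R t) = 2 *\<^sub>R proj k t" by (simp add: proj_def vec_eq_iff)
  then have "A_prod a (2 *\<^sub>R proj k t) = A_prod a (2 *\<^sub>R t)"
    using A_prod_proj[OF scaleR_orthant[OF t], of 2 k] k by (simp add: infnorm_mul)
  then show "C t = C (proj k t)"
    using t k by (simp add: C proj_orthant A_prod_proj)
next
  fix t :: "real ^ 'n"
  assume "t \<in> dilate (1/2) B_1"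
  then obtain s where s: "s \<in> orthant" "(\<Sum>k\<in>UNIV. \<bar>s $ k\<bar>) \<le> 1" "t = (1/2) *\<^sub>R s"
    by (auto simp: dilate_def B_1_def)
  have "s $ k \<le> 1" for k
  proof -
    have "\<bar>s $ k\<bar> \<le> (\<Sum>k\<in>UNIV. \<bar>s $ k\<bar>)" by (rule member_le_sum) auto
    then show ?thesis using s(2) by linarith
  qed
  then have "A_prod a (2 *\<^sub>R t) = 1" using s by (simp add: A_prod_eq_1)
  then show "C t = 0" using s h1 by (simp add: C scaleR_orthant)
next
  fix t :: "real ^ 'n"
  assume "t \<in> orthant - {t. \<forall>k. t $ k \<in> {0..<1}}"
  then obtain i where t: "t \<in> orthant" and i: "t $ i \<ge> 1"
    by (auto simp: orthant_def not_less)
  have g1: "(g 1)\<^sup>2 = 1" using gh[of 1] h1 by simp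
  have C_sq: "(C u)\<^sup>2 = (g (A_prod a u))\<^sup>2 - (g (A_prod a (2 *\<^sub>R u)))\<^sup>2" if u: "u \<in> orthant" for u
  proof -
    have "(h (A_prod a (2 *\<^sub>R u)))\<^sup>2 = 1 - (g (A_prod a (2 *\<^sub>R u)))\<^sup>2"
      using gh[OF A_prod_range[OF scaleR_orthant[OF u, of 2]]] by simp
    moreover have "A_prod a u = 1 \<or> A_prod a (2 *\<^sub>R u) = 0"
    proof (cases "\<forall>k. u $ k \<le> 1")
      case True
      then show ?thesis using A_prod_eq_1 u by blast
    next
      case False
      then obtain k where "u $ k > 1" by (auto simp: not_le)
      then have "(2 *\<^sub>R u) $ k \<ge> 2" by simp
      then show ?thesis using A_prod_eq_0 by blast
    qed
    ultimately show ?thesis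
      using g0 g1 by (auto simp: C[OF u] power_mult_distrib)
  qed
  \<comment> \<open>The sequence starts at the dilate \<open>2t\<close>, where \<open>A\<close> vanishes, and ends near \<open>0\<close>, where \<open>A\<close> is \<open>1\<close>.\<close>
  define f where "f n = (g (A_prod a ((2 / 2 ^ n) *\<^sub>R t)))\<^sup>2" for n :: nat
  have "f (Suc n) - f n = \<bar>C ((1 / 2 ^ n) *\<^sub>R t)\<bar>\<^sup>2" for n
    using C_sq[OF scaleR_orthant[OF t, of "1 / 2 ^ n"]] by (simp add: f_def)
  moreover have "f 0 = 0"
    using A_prod_eq_0[of "2 *\<^sub>R t" i] i g0 by (simp add: f_def)
  moreover have "f \<longlonglongrightarrow> 1"
  proof (rule tendsto_eventually)
    have "(\<lambda>n. (2 / 2 ^ n) * infnorm t) \<longlonglongrightarrow> 0"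
      by (intro tendsto_mult_left_zero LIMSEQ_divide_realpow_zero) simp
    then have "\<forall>\<^sub>F n in sequentially. (2 / 2 ^ n) * infnorm t < 1"
      by (rule order_tendstoD) simp
    then show "\<forall>\<^sub>F n in sequentially. f n = 1"
    proof eventually_elim
      case (elim n)
      have u: "(2 / 2 ^ n) *\<^sub>R t \<in> orthant" using t by (intro scaleR_orthant) auto
      have "infnorm ((2 / 2 ^ n) *\<^sub>R t) \<le> 1" using elim by (simp add: infnorm_mul)
      then show ?case
        using A_prod_eq_1[OF u] infnorm_le_iff_orthant[OF u] g1 unfolding f_def by metis
    qed
  qed
  ultimately show "(\<lambda>j. \<bar>C ((1 / 2 ^ j) *\<^sub>R t)\<bar>\<^sup>2) sums 1"
    using telescope_sums[of f 1] by simp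
qed

lemma C_sqrt_eq:
  assumes t: "t \<in> orthant"
  shows "C_sqrt a t =
    (A_prod a t * sqrt (2 - (A_prod a t)\<^sup>2)) * (1 - (A_prod a (2 *\<^sub>R t))\<^sup>2)"
proof (cases "\<forall>k. t $ k \<le> 1")
  case True
  then show ?thesis using t A_prod_eq_1[OF t] by (simp add: C_sqrt_def B_inf_iff)
next
  case False
  then obtain k where k: "t $ k > 1" by (auto simp: not_le)
  then have "A_prod a (2 *\<^sub>R t) = 0" by (intro A_prod_eq_0[of _ k]) simp
  moreover have "A_prod a t = 0" if "\<not> (\<forall>k. t $ k \<le> 2)"
    using that A_prod_eq_0[of t] by (meson less_eq_real_def not_le)
  ultimately show ?thesis
    using t False by (auto simp: C_sqrt_def B_inf_iff dilate_B_inf_iff)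
qed

lemma C_trig_eq:
  assumes t: "t \<in> orthant"
  shows "C_trig a t = sin (pi / 2 * A_prod a t) * cos (pi / 2 * A_prod a (2 *\<^sub>R t))"
proof (cases "\<forall>k. t $ k \<le> 1")
  case True
  moreover have "A_prod a (2 *\<^sub>R t) = 1" if "\<forall>k. t $ k \<le> 1/2"
    using that by (intro A_prod_eq_1 scaleR_orthant[OF t]) (auto simp: field_simps)
  ultimately show ?thesis
    using t A_prod_eq_1[OF t] by (auto simp: C_trig_def B_inf_iff dilate_B_inf_iff)
next
  case False
  then obtain k where k: "t $ k > 1" by (auto simp: not_le)
  then have "A_prod a (2 *\<^sub>R t) = 0" by (intro A_prod_eq_0[of _ k]) simp
  moreover have "\<not> (\<forall>k. t $ k \<le> 1/2)"
  proof
    assume "\<forall>k. t $ k \<le> 1/2"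
    from this[rule_format, of k] k show False by simp
  qed
  moreover have "A_prod a t = 0" if "\<not> (\<forall>k. t $ k \<le> 2)"
    using that A_prod_eq_0[of t] by (meson less_eq_real_def not_le)
  ultimately show ?thesis
    using t False by (auto simp: C_trig_def B_inf_iff dilate_B_inf_iff)
qed

end


section \<open>The two cutoff functions\<close>

theorem lemma3p14:
  fixes a :: "'n::finite \<Rightarrow> real \<Rightarrow> real"
  assumes "\<And>j. admissible_a (a j)"
    and "\<And>j t. t \<ge> 0 \<Longrightarrow> 0 \<le> a j t \<and> a j t \<le> 1"
  shows "((\<forall>t\<in>orthant. 0 \<le> C_sqrt a t) \<and> admissible_second_kind_c (C_sqrt a)) \<and>
         ((\<forall>t\<in>orthant. 0 \<le> C_trig a t) \<and> admissible_second_kind_c (C_trig a))"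
proof (intro conjI ballI)
  have bounds: "\<forall>j. \<forall>t\<ge>0. 0 \<le> a j t \<and> a j t \<le> 1" using assms(2) by blast
  note range = A_prod_range[of a, OF assms(1) bounds]
    and range2 = A_prod_range[of a, OF assms(1) bounds scaleR_orthant]
  have sq_le: "s\<^sup>2 \<le> 1" if "s \<in> {0..1}" for s :: real
    using that by (simp add: power_le_one)
  have trig_nonneg: "0 \<le> sin (pi / 2 * s)" "0 \<le> cos (pi / 2 * s)" if "s \<in> {0..1}" for s :: real
  proof -
    have "0 \<le> pi / 2 * s" "pi / 2 * s \<le> pi / 2" using that by simp_all
    then show "0 \<le> sin (pi / 2 * s)" "0 \<le> cos (pi / 2 * s)"
      by (intro sin_ge_zero cos_ge_zero; linarith)+
  qed
  have id: "smooth_on S (\<lambda>s::real. s)" for S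
    by (rule smooth_on_bounded_linear) (rule bounded_linear_ident)
  show "0 \<le> C_sqrt a t" if t: "t \<in> orthant" for t
    unfolding C_sqrt_eq[of a, OF assms(1) bounds t]
    using range[OF t] sq_le[OF range[OF t]] sq_le[OF range2[OF t, of 2]]
    by (intro mult_nonneg_nonneg) auto
  show "0 \<le> C_trig a t" if t: "t \<in> orthant" for t
    unfolding C_trig_eq[of a, OF assms(1) bounds t]
    by (intro mult_nonneg_nonneg trig_nonneg range range2 t) simp
  show "admissible_second_kind_c (C_sqrt a)"
  proof (rule admissible_second_kind_c_quadrature[of a "C_sqrt a" "\<lambda>s. s * sqrt (2 - s\<^sup>2)"
        "\<lambda>s. 1 - s\<^sup>2", OF assms(1) bounds C_sqrt_eq[of a, OF assms(1) bounds]])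
    have diff_sq: "smooth_on {0..1} (\<lambda>s::real. c - s\<^sup>2)" for c
      using smooth_on_add[OF smooth_on_const[of _ c]
          smooth_on_mult[OF smooth_on_const[of _ "-1"] smooth_on_mult[OF id id]]]
      by (simp add: power2_eq_square)
    then show "smooth_on {0..1} (\<lambda>s::real. 1 - s\<^sup>2)" .
    have "(\<lambda>s::real. 2 - s\<^sup>2) ` {0..1} \<subseteq> {0<..}" using sq_le by force
    then show "smooth_on {0..1} (\<lambda>s. s * sqrt (2 - s\<^sup>2))"
      by (intro smooth_on_mult id smooth_on_compose[OF smooth_on_sqrt] diff_sq)
    show "(s * sqrt (2 - s\<^sup>2))\<^sup>2 + (1 - s\<^sup>2)\<^sup>2 = 1" if "s \<in> {0..1}" for s :: real
      using sq_le[OF that] by (simp add: power_mult_distrib) (simp add: power2_eq_square algebra_simps)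
  qed auto
  have linear_smooth: "smooth_on {0..1} (\<lambda>s. pi * s / 2)"
    using smooth_on_mult[OF smooth_on_const[of _ "pi / 2"] id] by simp
  show "admissible_second_kind_c (C_trig a)"
    by (rule admissible_second_kind_c_quadrature[of a "C_trig a" "\<lambda>s. sin (pi / 2 * s)"
          "\<lambda>s. cos (pi / 2 * s)", OF assms(1) bounds C_trig_eq[of a, OF assms(1) bounds]])
      (auto intro!: smooth_on_compose[OF smooth_on_sin] smooth_on_compose[OF smooth_on_cos]
        linear_smooth)
qed

end
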